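(* Assume the Continuum Hypothesis. Then for every real $a \in (0,1]$, $\clubsuit^{\inf \geq a}$ implies $\diamondsuit$.
   Context: $\mathrm{Lim}(\omega_1)$ is the set of all countable limit ordinals (limit ordinals below $\omega_1$). $[\omega_1]^{\aleph_1}$ is the set of uncountable subsets of $\omega_1$. For $a \in (0,1]$, the principle $\clubsuit^{\inf \geq a}$ says: there exists $\bar{A} = \langle A_\delta : \delta \in \mathrm{Lim}(\omega_1)\rangle$ such that (a) each $A_\delta = \{\alpha_{\delta,n} : n<\omega\}$ where the $\alpha_{\delta,n}$ are increasing with $n$ and cofinal in $\delta$, and (b) for every $A \in [\omega_1]^{\aleph_1}$ there exists $\delta \in \mathrm{Lim}(\omega_1)$ such that $$\liminf_n \frac{|\{k<n : \alpha_{\delta,k} \in A\}|}{n} \geq a.$$ The principle $\diamondsuit$ says: there exists $\langle A_\delta : \delta \in \mathrm{Lim}(\omega_1)\rangle$ with each $A_\delta \subseteq \delta$ such that for every $A \in [\omega_1]^{\aleph_1}$, the set $\{\delta \in \mathrm{Lim}(\omega_1) : A_\delta = A \cap \delta\}$ is stationary in $\omega_1$. *)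

theory Defs
  imports "HOL-Analysis.Analysis" "HOL-Library.Countable_Set_Type"
begin

unbundle cardinal_syntax

text \<open>
  The ordinal \<open>\<omega>\<^sub>1\<close>, as a well-ordered type: the cardinal successor of \<^term>\<open>natLeq\<close> (that is, of
  \<open>\<omega> = \<aleph>\<^sub>0\<close>) is an initial well-order relation of order type \<open>\<omega>\<^sub>1\<close>, and the type is its field.
\<close>

lemma Card_order_cardSuc_natLeq: "Card_order (cardSuc natLeq)"
  by (rule cardSuc_Card_order[OF natLeq_Card_order])

lemma Well_order_cardSuc_natLeq: "Well_order (cardSuc natLeq)"
  using Card_order_cardSuc_natLeq by (auto simp: card_order_on_def)

lemma natLeq_ordLess_cardSuc: "natLeq <o cardSuc natLeq"
  by (rule cardSuc_greater[OF natLeq_Card_order])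

lemma uncountable_Field_cardSuc_natLeq: "uncountable (Field (cardSuc natLeq))"
proof
  assume "countable (Field (cardSuc natLeq))"
  then have "|Field (cardSuc natLeq)| \<le>o natLeq"
    using countable_card_le_natLeq by blast
  moreover have "|Field (cardSuc natLeq)| =o cardSuc natLeq"
    by (rule card_of_Field_ordIso[OF Card_order_cardSuc_natLeq])
  ultimately have "cardSuc natLeq \<le>o natLeq"
    using ordIso_ordLeq_trans ordIso_symmetric by blast
  then show False
    using natLeq_ordLess_cardSuc not_ordLess_ordLeq by blast
qed

typedef omega1 = "Field (cardSuc natLeq)"
  using uncountable_Field_cardSuc_natLeq by (metis countable_empty ex_in_conv)

instantiation omega1 :: wellorder
begin

definition less_eq_omega1 :: "omega1 \<Rightarrow> omega1 \<Rightarrow> bool" where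
  "\<alpha> \<le> \<beta> \<longleftrightarrow> (Rep_omega1 \<alpha>, Rep_omega1 \<beta>) \<in> cardSuc natLeq"

definition less_omega1 :: "omega1 \<Rightarrow> omega1 \<Rightarrow> bool" where
  "\<alpha> < \<beta> \<longleftrightarrow> \<alpha> \<le> \<beta> \<and> \<alpha> \<noteq> (\<beta> :: omega1)"

instance
proof
  note W = Well_order_cardSuc_natLeq[unfolded order_on_defs]
  fix x y z :: omega1
  show antisym': "x = y" if "x \<le> y" "y \<le> x" for x y :: omega1
    using that W unfolding less_eq_omega1_def antisym_def by (metis Rep_omega1_inject)
  show "(x < y) = (x \<le> y \<and> \<not> y \<le> x)"
    using antisym' W Rep_omega1 by (auto simp: less_omega1_def less_eq_omega1_def refl_on_def)
  show "x \<le> x"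
    using W Rep_omega1 by (auto simp: less_eq_omega1_def refl_on_def)
  show "x \<le> z" if "x \<le> y" "y \<le> z"
    using that W unfolding less_eq_omega1_def trans_def by blast
  show "x \<le> y \<or> y \<le> x"
  proof (cases "x = y")
    case True
    then show ?thesis using \<open>x \<le> x\<close> by simp
  next
    case False
    then have "Rep_omega1 x \<noteq> Rep_omega1 y" by (simp add: Rep_omega1_inject)
    then show ?thesis
      using W Rep_omega1[of x] Rep_omega1[of y]
      unfolding less_eq_omega1_def total_on_def by blast
  qed
next
  fix P :: "omega1 \<Rightarrow> bool" and a :: omega1
  assume step: "\<And>x. (\<And>y. y < x \<Longrightarrow> P y) \<Longrightarrow> P x"
  have "wf (cardSuc natLeq - Id)"
    using Well_order_cardSuc_natLeq by (simp add: well_order_on_def)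
  then have "wf (inv_image (cardSuc natLeq - Id) Rep_omega1)" by simp
  moreover have "(y, x) \<in> inv_image (cardSuc natLeq - Id) Rep_omega1 \<longleftrightarrow> y < x" for x y
    by (simp add: less_omega1_def less_eq_omega1_def Rep_omega1_inject)
  ultimately show "P a"
    using step by (induction a rule: wf_induct_rule) blast
qed

end

text \<open>
  The two properties that determine \<open>\<omega>\<^sub>1\<close> up to isomorphism: it is uncountable, and all its proper
  initial segments are countable.
\<close>

lemma uncountable_omega1: "uncountable (UNIV :: omega1 set)"
  using uncountable_Field_cardSuc_natLeq type_definition.Rep_range[OF type_definition_omega1]
  by (metis countable_image)

lemma countable_lessThan_omega1: "countable {..<\<alpha> :: omega1}"
proof -
  have "|underS (cardSuc natLeq) (Rep_omega1 \<alpha>)| <o cardSuc natLeq"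
    by (rule card_of_underS[OF Card_order_cardSuc_natLeq Rep_omega1])
  then have "|underS (cardSuc natLeq) (Rep_omega1 \<alpha>)| \<le>o natLeq"
    using cardSuc_ordLeq_ordLess[OF natLeq_Card_order card_of_Card_order] by blast
  then have "countable (underS (cardSuc natLeq) (Rep_omega1 \<alpha>))"
    by (simp add: countable_card_le_natLeq)
  moreover have "Rep_omega1 ` {..<\<alpha>} \<subseteq> underS (cardSuc natLeq) (Rep_omega1 \<alpha>)"
    by (auto simp: underS_def less_omega1_def less_eq_omega1_def Rep_omega1_inject)
  ultimately have "countable (Rep_omega1 ` {..<\<alpha>})"
    by (rule countable_subset[rotated])
  then show ?thesis
    by (rule countable_image_inj_on) (auto simp: inj_on_def Rep_omega1_inject)
qed

text \<open>\<open>2\<^bsup>\<aleph>\<^sub>0\<^esup> = \<aleph>\<^sub>1\<close>.\<close>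

definition continuum_hypothesis :: bool where
  "continuum_hypothesis \<longleftrightarrow> ctwo ^c natLeq =o cardSuc natLeq"

text \<open>\<open>Lim(\<omega>\<^sub>1)\<close>; the ordinal 0 is not counted as a limit ordinal.\<close>

definition Lim_omega1 :: "omega1 set" where
  "Lim_omega1 = {\<delta>. (\<exists>\<beta>. \<beta> < \<delta>) \<and> (\<forall>\<beta><\<delta>. \<exists>\<gamma>. \<beta> < \<gamma> \<and> \<gamma> < \<delta>)}"

definition club_omega1 :: "omega1 set \<Rightarrow> bool" where
  "club_omega1 C \<longleftrightarrow>
     (\<forall>\<beta>. \<exists>\<gamma>\<in>C. \<beta> < \<gamma>) \<and>
     (\<forall>\<delta>\<in>Lim_omega1. (\<forall>\<beta><\<delta>. \<exists>\<gamma>\<in>C. \<beta> < \<gamma> \<and> \<gamma> < \<delta>) \<longrightarrow> \<delta> \<in> C)"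

definition stationary_omega1 :: "omega1 set \<Rightarrow> bool" where
  "stationary_omega1 S \<longleftrightarrow> (\<forall>C. club_omega1 C \<longrightarrow> S \<inter> C \<noteq> {})"

text \<open>
  The principle \<open>\<clubsuit>\<^bsup>inf \<ge> a\<^esup>\<close>. The values of \<open>A\<close> and \<open>\<alpha>\<close> outside \<^const>\<open>Lim_omega1\<close> are
  irrelevant, and so is the term \<open>n = 0\<close> of the sequence (where the quotient is \<open>0 / 0 = 0\<close>).
\<close>

definition clubsuit_inf_ge :: "real \<Rightarrow> bool" where
  "clubsuit_inf_ge a \<longleftrightarrow>
     (\<exists>(A :: omega1 \<Rightarrow> omega1 set) (\<alpha> :: omega1 \<Rightarrow> nat \<Rightarrow> omega1).
        (\<forall>\<delta>\<in>Lim_omega1.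
           A \<delta> = range (\<alpha> \<delta>) \<and> strict_mono (\<alpha> \<delta>) \<and>
           (\<forall>n. \<alpha> \<delta> n < \<delta>) \<and> (\<forall>\<beta><\<delta>. \<exists>n. \<beta> \<le> \<alpha> \<delta> n)) \<and>
        (\<forall>X :: omega1 set. uncountable X \<longrightarrow>
           (\<exists>\<delta>\<in>Lim_omega1.
              liminf (\<lambda>n. ereal (real (card {k. k < n \<and> \<alpha> \<delta> k \<in> X}) / real n)) \<ge> ereal a)))"

definition diamond :: bool where
  "diamond \<longleftrightarrow>
     (\<exists>A :: omega1 \<Rightarrow> omega1 set.
        (\<forall>\<delta>\<in>Lim_omega1. A \<delta> \<subseteq> {..<\<delta>}) \<and>
        (\<forall>X :: omega1 set. uncountable X \<longrightarrow>
           stationary_omega1 {\<delta> \<in> Lim_omega1. A \<delta> = X \<inter> {..<\<delta>}}))"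

end

theory Submission
  imports Defs
begin

text \<open>
  By CH, the countable ordinals enumerate all sequences of countable subsets of \<open>\<omega>\<^sub>1\<close>, each
  of them uncountably often. At a limit ordinal \<open>\<delta>\<close> the ladder yields codes of partial
  sequences, and we collect all sequences of subsets of \<open>\<delta>\<close> that are approximated along a set of
  indices of lower density at least \<open>a\<close>. Distinct sequences use almost disjoint index sets, so there
  are at most \<open>1/a\<close> of them. As in Kunen's proof that \<open>\<diamondsuit>\<close> follows from its version with
  countably many guesses, guessing sequences \<open>(X\<^sub>n)\<close> and taking the diagonal shows that for some
  \<open>n\<close> the \<open>n\<close>-th entry of the \<open>n\<close>-th guess is a \<open>\<diamondsuit>\<close>-sequence: otherwise counterexamples
  \<open>X\<^sub>n\<close>, \<open>C\<^sub>n\<close> are coded by a single uncountable set whose limit points all lie in every \<open>C\<^sub>n\<close>.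
\<close>

section \<open>Almost disjoint sets of positive lower density\<close>

definition lower_density :: "nat set \<Rightarrow> ereal" where
  "lower_density S = liminf (\<lambda>n. ereal (real (card {k. k < n \<and> k \<in> S}) / real n))"

text \<open>Beyond a common bound \<open>N\<close>, finitely many of the sets are pairwise disjoint.
  If more than \<open>2 / a\<close> of them each fill over \<open>a / 2\<close> of every long
  initial segment, together they overfill it.\<close>

lemma finite_almost_disjoint_lower_density:
  fixes S :: "'i \<Rightarrow> nat set" and a :: real
  assumes a: "0 < a"
    and dens: "\<And>i. i \<in> I \<Longrightarrow>
      ereal a \<le> lower_density (S i)"
    and disj: "\<And>i j. i \<in> I \<Longrightarrow> j \<in> I \<Longrightarrow> i \<noteq> j \<Longrightarrow> finite (S i \<inter> S j)"
  shows "finite I"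
proof (rule ccontr)
  assume "infinite I"
  define M where "M = nat \<lceil>2 / a\<rceil> + 1"
  obtain J where J: "J \<subseteq> I" "finite J" "card J = M"
    using infinite_arbitrarily_large[OF \<open>infinite I\<close>] by metis
  have M: "real M * (a / 2) > 1"
  proof -
    have "real M > 2 / a" unfolding M_def by linarith
    then show ?thesis using a by (simp add: field_simps)
  qed
  have "finite (\<Union>i\<in>J. \<Union>j\<in>J - {i}. S i \<inter> S j)"
    using J disj by (intro finite_UN_I) auto
  then obtain N where "\<forall>k\<in>(\<Union>i\<in>J. \<Union>j\<in>J - {i}. S i \<inter> S j). k < N"
    using finite_nat_set_iff_bounded by blast
  then have N: "k < N" if "i \<in> J" "j \<in> J" "i \<noteq> j" "k \<in> S i" "k \<in> S j" for i j k
    using that by blast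
  \<comment> \<open>Passing to \<open>a / 2\<close> turns the bound on the liminf into a strict
    inequality that holds from some point on.\<close>
  have "\<forall>\<^sub>F n in sequentially. a / 2 < real (card {k. k < n \<and> k \<in> S i}) / real n" if "i \<in> J" for i
  proof -
    have "ereal (a / 2) < ereal a" using a by simp
    also have "\<dots> \<le> lower_density (S i)"
      using J that by (intro dens) blast
    finally have "ereal (a / 2) < lower_density (S i)" .
    from less_LiminfD[OF this[unfolded lower_density_def]] show ?thesis by simp
  qed
  then have "\<forall>\<^sub>F n in sequentially. \<forall>i\<in>J. a / 2 < real (card {k. k < n \<and> k \<in> S i}) / real n"
    using J by (simp add: eventually_ball_finite)
  then obtain n0 where n0: "\<And>n i. n \<ge> n0 \<Longrightarrow> i \<in> J \<Longrightarrow>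
      a / 2 < real (card {k. k < n \<and> k \<in> S i}) / real n"
    by (auto simp: eventually_sequentially)
  have bound: "(real M * (a / 2) - 1) * real n \<le> real M * real N" if "n \<ge> n0" "n > 0" for n
  proof -
    let ?B = "\<lambda>i. {k. N \<le> k \<and> k < n \<and> k \<in> S i}"
    have "a / 2 * real n - real N \<le> real (card (?B i))" if "i \<in> J" for i
    proof -
      have "card {k. k < n \<and> k \<in> S i} \<le> card ({..<N} \<union> ?B i)"
        by (intro card_mono) auto
      also have "\<dots> \<le> N + card (?B i)"
        using card_Un_le[of "{..<N}" "?B i"] by simp
      finally have "real (card {k. k < n \<and> k \<in> S i}) \<le> real N + real (card (?B i))" by simp
      moreover have "a / 2 * real n < real (card {k. k < n \<and> k \<in> S i})"
        using n0[OF \<open>n \<ge> n0\<close> that] \<open>n > 0\<close> by (simp add: field_simps)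
      ultimately show ?thesis by linarith
    qed
    then have "(\<Sum>i\<in>J. a / 2 * real n - real N) \<le> (\<Sum>i\<in>J. real (card (?B i)))"
      by (rule sum_mono)
    also have "\<dots> = real (card (\<Union>i\<in>J. ?B i))"
      using J(2) by (subst card_UN_disjoint) (auto dest: N)
    also have "\<dots> \<le> real (card {..<n})"
      by (intro of_nat_mono card_mono) auto
    finally have "real M * (a / 2 * real n - real N) \<le> real n"
      using J by simp
    then show ?thesis by (simp add: algebra_simps)
  qed
  \<comment> \<open>Since \<open>e\<close> is positive, the left side of \<open>bound\<close> grows
    without limit while the right side is fixed.\<close>
  define e where "e = real M * (a / 2) - 1"
  have "0 < e" using M by (simp add: e_def)
  obtain m :: nat where "real M * real N / e < real m"
    using reals_Archimedean2 by blast
  then have "real M * real N < real m * e"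
    using \<open>0 < e\<close> by (simp add: pos_divide_less_eq)
  also have "\<dots> \<le> e * real (m + n0 + 1)"
    using \<open>0 < e\<close> by (simp add: algebra_simps)
  finally show False using bound[of "m + n0 + 1"] by (simp add: e_def)
qed

text \<open>A finite \<open>S\<close> is almost disjoint from itself, so infinitely many copies of
  it would contradict the previous lemma.\<close>

lemma infinite_lower_density:
  fixes S :: "nat set" and a :: real
  assumes "0 < a"
    and "ereal a \<le> lower_density S"
  shows "infinite S"
proof
  assume "finite S"
  have "finite (UNIV :: nat set)"
    by (rule finite_almost_disjoint_lower_density[where S = "\<lambda>_. S", OF assms])
      (simp add: \<open>finite S\<close>)
  then show False by simp
qed

section \<open>Coding sequences of countable sets by countable ordinals\<close>

lemma countable_bounded_omega1:
  fixes B :: "omega1 set"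
  assumes "countable B"
  shows "\<exists>\<beta>. \<forall>b\<in>B. b < \<beta>"
proof -
  have "countable (\<Union>b\<in>B. {..<b} \<union> {b})"
    using assms countable_lessThan_omega1 by (intro countable_UN) auto
  then obtain \<beta> where "\<beta> \<notin> (\<Union>b\<in>B. {..<b} \<union> {b})"
    using uncountable_omega1 by (metis UNIV_eq_I)
  then show ?thesis by (intro exI[of _ \<beta>]) (auto simp: not_less le_less)
qed

lemma uncountable_unbounded_omega1:
  fixes B :: "omega1 set"
  assumes "uncountable B"
  shows "\<exists>b\<in>B. \<beta> \<le> b"
  using assms countable_subset[OF _ countable_lessThan_omega1[of \<beta>], of B]
  by (meson lessThan_iff not_less subsetI)

lemma ex_bij_omega1_nat_set:
  assumes continuum_hypothesis
  shows "\<exists>b :: omega1 \<Rightarrow> nat set. bij b"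
proof -
  have "bij_betw Rep_omega1 UNIV (Field (cardSuc natLeq))"
    using type_definition.Rep_range[OF type_definition_omega1]
    by (auto simp: bij_betw_def inj_on_def Rep_omega1_inject)
  then have "|UNIV :: omega1 set| =o |Field (cardSuc natLeq)|"
    using card_of_ordIso by blast
  also have "|Field (cardSuc natLeq)| =o cardSuc natLeq"
    by (rule card_of_Field_ordIso[OF Card_order_cardSuc_natLeq])
  also have "cardSuc natLeq =o ctwo ^c natLeq"
    using assms ordIso_symmetric unfolding continuum_hypothesis_def by blast
  also have "ctwo ^c natLeq =o ctwo ^c |UNIV :: nat set|"
    by (intro cexp_cong2 ordIso_symmetric[OF card_of_nat] Card_order_ctwo natLeq_Card_order
        card_of_Card_order)
  also have "ctwo ^c |UNIV :: nat set| =o |Pow (UNIV :: nat set)|"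
    unfolding ctwo_def cexp_def Field_card_of by (rule ordIso_symmetric[OF card_of_Pow_Func])
  finally have "|UNIV :: omega1 set| =o |UNIV :: nat set set|" by simp
  then show ?thesis using card_of_ordIso by blast
qed

lemma ex_enumeration_countable_set_sequences:
  assumes continuum_hypothesis
  shows "\<exists>G :: omega1 \<Rightarrow> nat \<Rightarrow> omega1 set. \<forall>Y. (\<forall>n. countable (Y n)) \<longrightarrow> Y \<in> range G"
proof -
  obtain b :: "omega1 \<Rightarrow> nat set" where b: "bij b"
    using ex_bij_omega1_nat_set[OF assms] by blast
  \<comment> \<open>The codes \<open>c x\<close> are nonempty, so that an empty section codes no element.\<close>
  define c where "c x = insert 0 (Suc ` b x)" for x
  have c: "c x = c y \<longleftrightarrow> x = y" for x y
    using b unfolding c_def by (auto simp: bij_def inj_def inj_image_eq_iff insert_ident)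
  define G where "G \<alpha> n = {x. \<exists>m. c x = {k. prod_encode (n, prod_encode (m, k)) \<in> b \<alpha>}}" for \<alpha> n
  have "Y \<in> range G" if Y: "\<And>n. countable (Y n)" for Y
  proof -
    \<comment> \<open>Section \<open>(n, m)\<close> of \<open>R\<close> is the code of the
      \<open>m\<close>-th element of \<open>Y n\<close>. An empty \<open>Y n\<close> is excluded
      because \<open>from_nat_into\<close> is arbitrary there.\<close>
    define R where "R = {prod_encode (n, prod_encode (m, k)) | n m k.
      Y n \<noteq> {} \<and> k \<in> c (from_nat_into (Y n) m)}"
    obtain \<alpha> where \<alpha>: "b \<alpha> = R" using b by (metis bij_pointE)
    have sec: "{k. prod_encode (n, prod_encode (m, k)) \<in> R} =
        (if Y n = {} then {} else c (from_nat_into (Y n) m))" for n m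
      by (auto simp: R_def)
    have "G \<alpha> n = Y n" for n
    proof (cases "Y n = {}")
      case True
      then show ?thesis by (simp add: G_def \<alpha> sec) (simp add: c_def)
    next
      case False
      then have "G \<alpha> n = range (from_nat_into (Y n))"
        by (auto simp: G_def \<alpha> sec c)
      then show ?thesis using False Y by simp
    qed
    then show ?thesis by (metis ext rangeI)
  qed
  then show ?thesis by blast
qed

text \<open>Entry 0 of \<open>G\<close> serves as a free tag: prefixing \<open>Y\<close> with the
  uncountably many singletons gives distinct codes, and dropping the tag leaves
  \<open>Y\<close>.\<close>

lemma ex_repetitive_enumeration_countable_set_sequences:
  assumes continuum_hypothesis
  shows "\<exists>H :: omega1 \<Rightarrow> nat \<Rightarrow> omega1 set.
    \<forall>Y. (\<forall>n. countable (Y n)) \<longrightarrow> uncountable {\<alpha>. H \<alpha> = Y}"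
proof -
  obtain G :: "omega1 \<Rightarrow> nat \<Rightarrow> omega1 set"
    where G: "\<And>Y. (\<And>n. countable (Y n)) \<Longrightarrow> Y \<in> range G"
    using ex_enumeration_countable_set_sequences[OF assms] by blast
  define H where "H \<alpha> n = G \<alpha> (Suc n)" for \<alpha> n
  have "uncountable {\<alpha>. H \<alpha> = Y}" if Y: "\<And>n. countable (Y n)" for Y
  proof
    assume "countable {\<alpha>. H \<alpha> = Y}"
    moreover have "range (\<lambda>\<zeta>. {\<zeta>}) \<subseteq> (\<lambda>\<alpha>. G \<alpha> 0) ` {\<alpha>. H \<alpha> = Y}"
    proof (rule image_subsetI)
      fix \<zeta> :: omega1
      have "(\<lambda>n. case n of 0 \<Rightarrow> {\<zeta>} | Suc m \<Rightarrow> Y m) \<in> range G"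
        by (rule G) (auto simp: Y split: nat.split)
      then obtain \<alpha> where "G \<alpha> = (\<lambda>n. case n of 0 \<Rightarrow> {\<zeta>} | Suc m \<Rightarrow> Y m)" by auto
      then have "H \<alpha> = Y" "G \<alpha> 0 = {\<zeta>}" by (auto simp: H_def)
      then show "{\<zeta>} \<in> (\<lambda>\<alpha>. G \<alpha> 0) ` {\<alpha>. H \<alpha> = Y}" by force
    qed
    ultimately have "countable (range (\<lambda>\<zeta> :: omega1. {\<zeta>}))"
      by (meson countable_image countable_subset)
    then have "countable (UNIV :: omega1 set)"
      by (rule countable_image_inj_on) (auto simp: inj_def)
    then show False using uncountable_omega1 by blast
  qed
  then show ?thesis by blast
qed

section \<open>Guesses read off a ladder\<close>

text \<open>
  A code \<open>\<alpha>\<close> stands for the partial sequence \<open>H \<alpha> 1, H \<alpha> 2, \<dots>\<close> on the domain \<open>H \<alpha> 0\<close>.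
\<close>

definition approximates :: "(omega1 \<Rightarrow> nat \<Rightarrow> omega1 set) \<Rightarrow> (nat \<Rightarrow> omega1) \<Rightarrow> omega1 \<Rightarrow>
    nat set \<Rightarrow> (nat \<Rightarrow> omega1 set) \<Rightarrow> bool" where
  "approximates H l \<delta> S Y \<longleftrightarrow>
     (\<forall>k\<in>S. \<forall>n. H (l k) (Suc n) = Y n \<inter> H (l k) 0) \<and>
     (\<forall>\<xi><\<delta>. \<forall>\<^sub>F k in sequentially. k \<in> S \<longrightarrow> \<xi> \<in> H (l k) 0)"

definition guesses :: "(omega1 \<Rightarrow> nat \<Rightarrow> omega1 set) \<Rightarrow> real \<Rightarrow> (nat \<Rightarrow> omega1) \<Rightarrow> omega1 \<Rightarrow>
    (nat \<Rightarrow> omega1 set) set" where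
  "guesses H a l \<delta> = {Y. (\<forall>n. Y n \<subseteq> {..<\<delta>}) \<and>
     (\<exists>S. ereal a \<le> lower_density S \<and> approximates H l \<delta> S Y)}"

text \<open>Two distinct members differ at some point below \<open>\<delta>\<close>. That point
  eventually lies in every coded domain used by either, so a late index shared by both would force
  agreement there.\<close>

lemma finite_guesses:
  assumes "0 < a"
  shows "finite (guesses H a l \<delta>)"
proof -
  have "\<forall>Y\<in>guesses H a l \<delta>. \<exists>S. ereal a \<le> lower_density S \<and> approximates H l \<delta> S Y"
    by (simp add: guesses_def)
  from bchoice[OF this] obtain S
    where S_dens: "\<And>Y. Y \<in> guesses H a l \<delta> \<Longrightarrow> ereal a \<le> lower_density (S Y)"
      and S_approx: "\<And>Y. Y \<in> guesses H a l \<delta> \<Longrightarrow> approximates H l \<delta> (S Y) Y"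
    by blast
  show ?thesis
  proof (rule finite_almost_disjoint_lower_density[OF assms, where S = S])
    fix Y Z assume Y: "Y \<in> guesses H a l \<delta>" and Z: "Z \<in> guesses H a l \<delta>" and "Y \<noteq> Z"
    from \<open>Y \<noteq> Z\<close> obtain n where "Y n \<noteq> Z n" by (meson ext)
    then obtain \<xi> where \<xi>: "\<xi> \<in> Y n \<longleftrightarrow> \<xi> \<notin> Z n" by auto
    then have "\<xi> < \<delta>" using Y Z by (auto simp: guesses_def)
    then have "\<forall>\<^sub>F k in sequentially. k \<in> S Y \<longrightarrow> \<xi> \<in> H (l k) 0"
      using S_approx[OF Y] by (simp add: approximates_def)
    then obtain N where N: "\<And>k. k \<ge> N \<Longrightarrow> k \<in> S Y \<Longrightarrow> \<xi> \<in> H (l k) 0"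
      by (auto simp: eventually_sequentially)
    have "k < N" if "k \<in> S Y \<inter> S Z" for k
    proof (rule ccontr)
      assume "\<not> k < N"
      then have "\<xi> \<in> H (l k) 0" using N that by simp
      moreover have "Y n \<inter> H (l k) 0 = Z n \<inter> H (l k) 0"
        using S_approx[OF Y] S_approx[OF Z] that by (metis IntD1 IntD2 approximates_def)
      ultimately show False using \<xi> by blast
    qed
    then show "finite (S Y \<inter> S Z)" using finite_nat_set_iff_bounded by blast
  qed (rule S_dens)
qed

text \<open>The uncountable set to be hit consists of codes of restrictions of \<open>X\<close> to
  growing initial segments, spaced so that each \<open>C n\<close> has an element between any two of
  them.\<close>

lemma ex_guess:
  fixes C X :: "nat \<Rightarrow> omega1 set"
  assumes a: "0 < a"
    and ladder: "\<And>\<delta>. \<delta> \<in> Lim_omega1 \<Longrightarrow>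
      strict_mono (l \<delta>) \<and> (\<forall>n. l \<delta> n < \<delta>) \<and> (\<forall>\<beta><\<delta>. \<exists>n. \<beta> \<le> l \<delta> n)"
    and hit: "\<And>X. uncountable X \<Longrightarrow> \<exists>\<delta>\<in>Lim_omega1.
      ereal a \<le> lower_density {k. l \<delta> k \<in> X}"
    and H: "\<And>Y. (\<And>n. countable (Y n)) \<Longrightarrow> uncountable {\<alpha>. H \<alpha> = Y}"
    and C: "\<And>n. club_omega1 (C n)"
  shows "\<exists>\<delta>\<in>Lim_omega1. (\<forall>n. \<delta> \<in> C n) \<and> (\<lambda>n. X n \<inter> {..<\<delta>}) \<in> guesses H a (l \<delta>) \<delta>"
proof -
  \<comment> \<open>Entry 0 records the domain of the restriction, as \<open>approximates\<close>
    expects.\<close>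
  define Z where "Z \<beta> = (\<lambda>n. case n of 0 \<Rightarrow> {..<\<beta>} | Suc m \<Rightarrow> X m \<inter> {..<\<beta>})" for \<beta>
  have "countable (Z \<beta> n)" for \<beta> n
    using countable_lessThan_omega1 by (auto simp: Z_def split: nat.split)
  then have "\<exists>\<alpha>. \<beta> \<le> \<alpha> \<and> H \<alpha> = Z \<beta>" for \<beta>
    using uncountable_unbounded_omega1[OF H, of "Z \<beta>" \<beta>] by blast
  then obtain f where f: "\<And>\<beta>. \<beta> \<le> f \<beta>" "\<And>\<beta>. H (f \<beta>) = Z \<beta>" by metis
  \<comment> \<open>By recursion, \<open>c \<gamma>\<close> is placed above an element of every
    \<open>C n\<close> beyond each earlier code \<open>f (c \<gamma>')\<close>; only countably many
    demands arise at each stage.\<close>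
  have "\<exists>c :: omega1 \<Rightarrow> omega1. \<forall>\<gamma>. \<forall>\<gamma>'<\<gamma>. \<forall>n. \<exists>e\<in>C n. f (c \<gamma>') < e \<and> e \<le> c \<gamma>"
  proof (rule dependent_wellorder_choice)
    fix \<gamma> and c :: "omega1 \<Rightarrow> omega1"
    have "\<exists>e\<in>C n. f (c \<gamma>') < e" for \<gamma>' n using C[of n] by (auto simp: club_omega1_def)
    then have "\<forall>p. \<exists>e. e \<in> C (snd p) \<and> f (c (fst p)) < e" by blast
    from choice[OF this] obtain e
      where e: "\<And>\<gamma>' n. e (\<gamma>', n) \<in> C n \<and> f (c \<gamma>') < e (\<gamma>', n)" by auto
    have "countable (e ` ({..<\<gamma>} \<times> UNIV))"
      using countable_lessThan_omega1 by auto
    from countable_bounded_omega1[OF this] obtain \<beta>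
      where "\<And>\<gamma>' n. \<gamma>' < \<gamma> \<Longrightarrow> e (\<gamma>', n) < \<beta>" by auto
    then show "\<exists>\<beta>. \<forall>\<gamma>'<\<gamma>. \<forall>n. \<exists>e\<in>C n. f (c \<gamma>') < e \<and> e \<le> \<beta>"
      using e by (intro exI[of _ \<beta>]) (meson less_imp_le)
  qed auto
  then obtain c :: "omega1 \<Rightarrow> omega1" where "\<forall>\<gamma>. \<forall>\<gamma>'<\<gamma>. \<forall>n. \<exists>e\<in>C n. f (c \<gamma>') < e \<and> e \<le> c \<gamma>" ..
  then have c: "\<exists>e\<in>C n. f (c \<gamma>') < e \<and> e \<le> c \<gamma>" if "\<gamma>' < \<gamma>" for \<gamma> \<gamma>' n
    using that by blast
  have fc_less: "f (c \<gamma>') < c \<gamma>" if "\<gamma>' < \<gamma>" for \<gamma> \<gamma>'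
    using c[OF that, of 0] by auto
  then have "strict_mono (f \<circ> c)"
    using f(1) less_le_trans by (fastforce simp: strict_mono_def)
  then have less_iff: "f (c \<gamma>) < f (c \<gamma>') \<longleftrightarrow> \<gamma> < \<gamma>'" for \<gamma> \<gamma>'
    using strict_mono_less by fastforce
  have "uncountable (range (f \<circ> c))"
    using uncountable_omega1 countable_image_inj_on strict_mono_imp_inj_on \<open>strict_mono (f \<circ> c)\<close>
    by blast
  from hit[OF this] obtain \<delta> where \<delta>: "\<delta> \<in> Lim_omega1"
    and dens: "ereal a \<le> lower_density {k. l \<delta> k \<in> range (f \<circ> c)}"
    by blast
  define S where "S = {k. l \<delta> k \<in> range (f \<circ> c)}"
  have dens_S: "ereal a \<le> lower_density S"
    using dens by (simp add: S_def)
  have "infinite S" using infinite_lower_density[OF a dens_S] .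
  have mono: "strict_mono (l \<delta>)" and below: "\<And>n. l \<delta> n < \<delta>"
    and cofinal: "\<And>\<beta>. \<beta> < \<delta> \<Longrightarrow> \<exists>n. \<beta> \<le> l \<delta> n"
    using ladder[OF \<delta>] by auto
  \<comment> \<open>An infinite set of indices into a cofinal increasing ladder is still
    cofinal.\<close>
  have cofinal_S: "\<exists>k\<in>S. \<xi> < l \<delta> k" if \<xi>: "\<xi> < \<delta>" for \<xi>
  proof -
    obtain n where "\<xi> \<le> l \<delta> n" using cofinal[OF \<xi>] by blast
    moreover obtain k where "k \<in> S" "n < k"
      using \<open>infinite S\<close> by (meson infinite_nat_iff_unbounded)
    ultimately show ?thesis using mono by (meson le_less_trans strict_monoD)
  qed
  have S_cases: "\<exists>\<gamma>. l \<delta> k = f (c \<gamma>)" if "k \<in> S" for k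
    using that by (auto simp: S_def)
  have "\<delta> \<in> C n" for n
  proof -
    \<comment> \<open>Two ladder points in the set of codes, both above \<open>\<xi>\<close>,
      enclose an element of \<open>C n\<close>; hence \<open>\<delta>\<close> is a limit of
      \<open>C n\<close>.\<close>
    have "\<exists>e\<in>C n. \<xi> < e \<and> e < \<delta>" if \<xi>: "\<xi> < \<delta>" for \<xi>
    proof -
      obtain k where k: "k \<in> S" "\<xi> < l \<delta> k" using cofinal_S[OF \<xi>] by blast
      obtain k' where k': "k' \<in> S" "l \<delta> k < l \<delta> k'" using cofinal_S[OF below[of k]] by blast
      obtain \<gamma> \<gamma>' where \<gamma>: "l \<delta> k = f (c \<gamma>)" "l \<delta> k' = f (c \<gamma>')" using S_cases k k' by meson
      then have "\<gamma> < \<gamma>'" using k' less_iff by simp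
      then obtain e where e: "e \<in> C n" "f (c \<gamma>) < e" "e \<le> c \<gamma>'" using c by blast
      have "e \<le> l \<delta> k'"
        using e(3) f(1)[of "c \<gamma>'"] \<gamma>(2) by simp
      then have "e < \<delta>" using below[of k'] by (rule le_less_trans)
      moreover have "\<xi> < e" using k(2) e(2) \<gamma>(1) by simp
      ultimately show ?thesis using e(1) by blast
    qed
    then show ?thesis using C[of n] \<delta> by (auto simp: club_omega1_def)
  qed
  moreover have "(\<lambda>n. X n \<inter> {..<\<delta>}) \<in> guesses H a (l \<delta>) \<delta>"
  proof -
    have "H (l \<delta> k) (Suc n) = X n \<inter> {..<\<delta>} \<inter> H (l \<delta> k) 0" if k: "k \<in> S" for k n
    proof -
      obtain \<gamma> where \<gamma>: "l \<delta> k = f (c \<gamma>)" using S_cases[OF k] by blast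
      \<comment> \<open>The coded domain \<open>{..<c \<gamma>}\<close> thus lies below
        \<open>\<delta>\<close>, so cutting \<open>X n\<close> at \<open>\<delta>\<close> loses
        nothing on it.\<close>
      then have "c \<gamma> < \<delta>" using f(1)[of "c \<gamma>"] below[of k] by simp
      then show ?thesis by (auto simp: \<gamma> f(2) Z_def)
    qed
    moreover have "\<forall>\<^sub>F k in sequentially. k \<in> S \<longrightarrow> \<xi> \<in> H (l \<delta> k) 0" if \<xi>: "\<xi> < \<delta>" for \<xi>
    proof -
      obtain k where k: "k \<in> S" "\<xi> < l \<delta> k" using cofinal_S[OF \<xi>] by blast
      \<comment> \<open>The code at \<open>k'\<close> has domain \<open>{..<c \<gamma>'}\<close>,
        and \<open>c \<gamma>'\<close> exceeds the earlier code \<open>f (c \<gamma>)\<close>, which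
        is above \<open>\<xi>\<close>.\<close>
      have "\<xi> \<in> H (l \<delta> k') 0" if k': "k < k'" "k' \<in> S" for k'
      proof -
        obtain \<gamma> \<gamma>' where \<gamma>: "l \<delta> k = f (c \<gamma>)" "l \<delta> k' = f (c \<gamma>')" using S_cases k k' by meson
        then have "\<gamma> < \<gamma>'" using strict_monoD[OF mono \<open>k < k'\<close>] less_iff by simp
        then have "\<xi> < c \<gamma>'" using fc_less k(2) \<gamma>(1) by (metis less_trans)
        then show ?thesis by (simp add: \<gamma> f(2) Z_def)
      qed
      then show ?thesis by (auto intro: eventually_sequentiallyI[of "Suc k"])
    qed
    ultimately show ?thesis
      unfolding guesses_def approximates_def using dens_S by blast
  qed
  ultimately show ?thesis using \<delta> by blast
qed

section \<open>The diagonal argument\<close>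

theorem theorem1p2:
  assumes "continuum_hypothesis"
  shows "\<forall>a::real. 0 < a \<and> a \<le> 1 \<longrightarrow> clubsuit_inf_ge a \<longrightarrow> diamond"
proof (intro allI impI)
  fix a :: real
  assume "0 < a \<and> a \<le> 1" and "clubsuit_inf_ge a"
  then have a: "0 < a" by simp
  from \<open>clubsuit_inf_ge a\<close> obtain l :: "omega1 \<Rightarrow> nat \<Rightarrow> omega1"
    where ladder: "\<And>\<delta>. \<delta> \<in> Lim_omega1 \<Longrightarrow>
      strict_mono (l \<delta>) \<and> (\<forall>n. l \<delta> n < \<delta>) \<and> (\<forall>\<beta><\<delta>. \<exists>n. \<beta> \<le> l \<delta> n)"
    and hit: "\<And>X. uncountable X \<Longrightarrow> \<exists>\<delta>\<in>Lim_omega1.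
      ereal a \<le> lower_density {k. l \<delta> k \<in> X}"
    unfolding clubsuit_inf_ge_def lower_density_def mem_Collect_eq by blast
  obtain H :: "omega1 \<Rightarrow> nat \<Rightarrow> omega1 set"
    where H: "\<And>Y. (\<And>n. countable (Y n)) \<Longrightarrow> uncountable {\<alpha>. H \<alpha> = Y}"
    using ex_repetitive_enumeration_countable_set_sequences[OF assms] by blast
  \<comment> \<open>The first \<open>n\<close> selects the guess, the second its entry. The
    intersection keeps \<open>D n \<delta>\<close> below \<open>\<delta>\<close> even if there are
    no guesses and \<open>from_nat_into\<close> is arbitrary.\<close>
  define D where "D n \<delta> = from_nat_into (guesses H a (l \<delta>) \<delta>) n n \<inter> {..<\<delta>}" for n \<delta>
  show diamond
  proof (rule ccontr)
    assume "\<not> diamond"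
    have "\<forall>n. \<exists>X C. club_omega1 C \<and> {\<delta> \<in> Lim_omega1. D n \<delta> = X \<inter> {..<\<delta>}} \<inter> C = {}"
    proof
      fix n
      have "\<forall>\<delta>\<in>Lim_omega1. D n \<delta> \<subseteq> {..<\<delta>}" by (auto simp: D_def)
      with \<open>\<not> diamond\<close> show "\<exists>X C. club_omega1 C \<and>
          {\<delta> \<in> Lim_omega1. D n \<delta> = X \<inter> {..<\<delta>}} \<inter> C = {}"
        unfolding diamond_def stationary_omega1_def not_ex de_Morgan_conj
        by (auto dest!: spec[of _ "D n"])
    qed
    from choice[OF this] obtain X where
      "\<forall>n. \<exists>C. club_omega1 C \<and> {\<delta> \<in> Lim_omega1. D n \<delta> = X n \<inter> {..<\<delta>}} \<inter> C = {}" ..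
    from choice[OF this] obtain C where C: "\<And>n. club_omega1 (C n)"
      and avoid: "\<And>n. {\<delta> \<in> Lim_omega1. D n \<delta> = X n \<inter> {..<\<delta>}} \<inter> C n = {}"
      by blast
    have "\<exists>\<delta>\<in>Lim_omega1. (\<forall>n. \<delta> \<in> C n) \<and> (\<lambda>n. X n \<inter> {..<\<delta>}) \<in> guesses H a (l \<delta>) \<delta>"
      by (rule ex_guess) (fact a ladder hit H C)+
    then obtain \<delta> where \<delta>: "\<delta> \<in> Lim_omega1" "\<And>n. \<delta> \<in> C n"
      and guess: "(\<lambda>n. X n \<inter> {..<\<delta>}) \<in> guesses H a (l \<delta>) \<delta>"
      by blast
    \<comment> \<open>Finiteness of the guesses makes the enumeration exhaustive. The position
      \<open>n\<close> of the correct guess also picks the entry, so \<open>D n\<close> succeeds at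
      a point of \<open>C n\<close>.\<close>
    obtain n where "from_nat_into (guesses H a (l \<delta>) \<delta>) n = (\<lambda>n. X n \<inter> {..<\<delta>})"
      using from_nat_into_surj[OF countable_finite[OF finite_guesses[OF a]] guess] by blast
    then have "D n \<delta> = X n \<inter> {..<\<delta>}" by (simp add: D_def)
    with \<delta> avoid[of n] show False by blast
  qed
qed

end
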